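(* Let $k,n\geq1$ be integers. Every list $L_1,\dots,L_k$ of mutually orthogonal Latin squares of order $n$ is mutually invertible.
   Context: $[n]:=\{1,2,\dots,n\}$. A Latin square of order $n$ is an $n\times n$ array in which each row and each column is a permutation of $[n]$; equivalently a function $L:[n]^2\to[n]$ such that $L(x,\cdot)$ and $L(\cdot,y)$ are permutations of $[n]$ for all $x,y\in[n]$ (a $2$-dimensional Latin cube of order $n$). Two Latin squares $L,L'$ of order $n$ are orthogonal if superimposing them produces each element of $[n]\times[n]$ exactly once, i.e. $(x,y)\mapsto(L(x,y),L'(x,y))$ is a bijection of $[n]^2$. A list $L_1,\dots,L_k$ of Latin squares is mutually orthogonal if $L_i$ and $L_j$ are orthogonal for all $i\neq j$. An $m$-tuple $t=(t_1,\dots,t_m)\in[n]^m$ is viewed as a function $[m]\to[n]$ with $t(i)=t_i$. A set $X$ of $m$-tuples in $[n]^m$ is $2$-extendable if for all indices $s_1<s_2$ in $[m]$ and every $(x_1,x_2)\in[n]^2$ there exists a unique $t\in X$ such that $t(s_1)=x_1$ and $t(s_2)=x_2$. A list $L_1,\dots,L_k$ of Latin squares of order $n$ is mutually invertible if the set of $(k+2)$-tuples $\{(L_1(x,y),\dots,L_k(x,y),x,y):(x,y)\in[n]^2\}$ is $2$-extendable. *)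

theory Defs
  imports "HOL-Library.FuncSet"
begin

text \<open>
  A square array of order \<open>n\<close> is a curried function on \<open>nat\<close>; only its values on
  \<open>{1..n} \<times> {1..n}\<close> are ever used. A list \<open>L\<^sub>1, \<dots>, L\<^sub>k\<close> of squares is a family \<open>L\<close> whose
  members \<open>L i\<close> are used for \<open>i \<in> {1..k}\<close> only.
\<close>

definition latin_square :: "nat \<Rightarrow> (nat \<Rightarrow> nat \<Rightarrow> nat) \<Rightarrow> bool" where
  "latin_square n L \<longleftrightarrow>
     (\<forall>x\<in>{1..n}. bij_betw (\<lambda>y. L x y) {1..n} {1..n}) \<and>
     (\<forall>y\<in>{1..n}. bij_betw (\<lambda>x. L x y) {1..n} {1..n})"

definition orthogonal_squares ::
    "nat \<Rightarrow> (nat \<Rightarrow> nat \<Rightarrow> nat) \<Rightarrow> (nat \<Rightarrow> nat \<Rightarrow> nat) \<Rightarrow> bool" where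
  "orthogonal_squares n L L' \<longleftrightarrow>
     bij_betw (\<lambda>(x, y). (L x y, L' x y)) ({1..n} \<times> {1..n}) ({1..n} \<times> {1..n})"

definition mutually_orthogonal ::
    "nat \<Rightarrow> nat \<Rightarrow> (nat \<Rightarrow> nat \<Rightarrow> nat \<Rightarrow> nat) \<Rightarrow> bool" where
  "mutually_orthogonal k n L \<longleftrightarrow>
     (\<forall>i\<in>{1..k}. \<forall>j\<in>{1..k}. i \<noteq> j \<longrightarrow> orthogonal_squares n (L i) (L j))"

text \<open>
  The \<open>m\<close>-tuples over \<open>{1..n}\<close> are extensional functions, so that tuples are equal iff they
  agree on \<open>{1..m}\<close>; this matters for the unique existence in \<open>two_extendable\<close>.
\<close>

definition tuples :: "nat \<Rightarrow> nat \<Rightarrow> (nat \<Rightarrow> nat) set" where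
  "tuples m n = {1..m} \<rightarrow>\<^sub>E {1..n}"

definition two_extendable :: "nat \<Rightarrow> nat \<Rightarrow> (nat \<Rightarrow> nat) set \<Rightarrow> bool" where
  "two_extendable m n X \<longleftrightarrow>
     X \<subseteq> tuples m n \<and>
     (\<forall>s\<^sub>1\<in>{1..m}. \<forall>s\<^sub>2\<in>{1..m}. s\<^sub>1 < s\<^sub>2 \<longrightarrow>
        (\<forall>x\<^sub>1\<in>{1..n}. \<forall>x\<^sub>2\<in>{1..n}. \<exists>!t. t \<in> X \<and> t s\<^sub>1 = x\<^sub>1 \<and> t s\<^sub>2 = x\<^sub>2))"

text \<open>The tuple \<open>(L\<^sub>1(x,y), \<dots>, L\<^sub>k(x,y), x, y)\<close>.\<close>

definition squares_tuple ::
    "nat \<Rightarrow> (nat \<Rightarrow> nat \<Rightarrow> nat \<Rightarrow> nat) \<Rightarrow> nat \<Rightarrow> nat \<Rightarrow> nat \<Rightarrow> nat" where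
  "squares_tuple k L x y =
     (\<lambda>i\<in>{1..k + 2}. if i \<le> k then L i x y else if i = k + 1 then x else y)"

definition mutually_invertible ::
    "nat \<Rightarrow> nat \<Rightarrow> (nat \<Rightarrow> nat \<Rightarrow> nat \<Rightarrow> nat) \<Rightarrow> bool" where
  "mutually_invertible k n L \<longleftrightarrow>
     two_extendable (k + 2) n {squares_tuple k L x y | x y. x \<in> {1..n} \<and> y \<in> {1..n}}"

end

theory Submission
  imports Defs
begin

text \<open>
  Think of each of the \<open>k + 2\<close> coordinates of \<open>(L\<^sub>1(x,y), \<dots>, L\<^sub>k(x,y), x, y)\<close> as a function on the
  cells \<open>(x, y)\<close>. Extendability asks that any two of these functions together form a system of
  coordinates on the grid, that is, that the pair of them is a bijection of the grid
  (\<open>two_extendable_image\<close>). Hence there is one condition for each pair of coordinates. For two of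
  the squares it is their orthogonality. For a square together with the row index or the column
  index it says that each row or each column of the square is a permutation
  (\<open>latin_square_value_row\<close>, \<open>latin_square_value_column\<close>). For the row index together with the
  column index it is trivial.
\<close>

text \<open>
  Surjectivity of the pair of coordinates gives a tuple with the prescribed values. Injectivity
  says that the two values determine the parameter, hence the tuple.
\<close>

lemma two_extendable_image:
  assumes "\<And>p. p \<in> P \<Longrightarrow> T p \<in> tuples m n"
    and bij: "\<And>s\<^sub>1 s\<^sub>2. \<lbrakk>s\<^sub>1 \<in> {1..m}; s\<^sub>2 \<in> {1..m}; s\<^sub>1 < s\<^sub>2\<rbrakk>
      \<Longrightarrow> bij_betw (\<lambda>p. (T p s\<^sub>1, T p s\<^sub>2)) P ({1..n} \<times> {1..n})"
  shows "two_extendable m n (T ` P)"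
  unfolding two_extendable_def
proof (intro conjI ballI impI)
  show "T ` P \<subseteq> tuples m n"
    using assms(1) by auto
next
  fix s\<^sub>1 s\<^sub>2 x\<^sub>1 x\<^sub>2
  assume s: "s\<^sub>1 \<in> {1..m}" "s\<^sub>2 \<in> {1..m}" "s\<^sub>1 < s\<^sub>2"
    and x: "x\<^sub>1 \<in> {1..n}" "x\<^sub>2 \<in> {1..n}"
  note b = bij[OF s]
  have "(x\<^sub>1, x\<^sub>2) \<in> (\<lambda>p. (T p s\<^sub>1, T p s\<^sub>2)) ` P"
    using b x by (simp add: bij_betw_def)
  then obtain p where p: "p \<in> P" "T p s\<^sub>1 = x\<^sub>1" "T p s\<^sub>2 = x\<^sub>2"
    by auto
  have "q = p" if "q \<in> P" "T q s\<^sub>1 = x\<^sub>1" "T q s\<^sub>2 = x\<^sub>2" for q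
    using inj_onD[OF bij_betw_imp_inj_on[OF b], of q p] that p by simp
  with p show "\<exists>!t. t \<in> T ` P \<and> t s\<^sub>1 = x\<^sub>1 \<and> t s\<^sub>2 = x\<^sub>2"
    by blast
qed

text \<open>A fibrewise bijection over \<open>A\<close> is a bijection of the total spaces.\<close>

lemma bij_betw_fibrewise:
  assumes "\<And>x. x \<in> A \<Longrightarrow> bij_betw (f x) B C"
  shows "bij_betw (\<lambda>(x, y). (f x y, x)) (A \<times> B) (C \<times> A)"
proof (rule bij_betw_imageI)
  show "inj_on (\<lambda>(x, y). (f x y, x)) (A \<times> B)"
    using assms by (auto simp: inj_on_def bij_betw_def)
  show "(\<lambda>(x, y). (f x y, x)) ` (A \<times> B) = C \<times> A"
    using assms by (fastforce simp: bij_betw_def)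
qed

lemma latin_square_value_row:
  assumes "latin_square n L"
  shows "bij_betw (\<lambda>(x, y). (L x y, x)) ({1..n} \<times> {1..n}) ({1..n} \<times> {1..n})"
  using assms by (intro bij_betw_fibrewise) (auto simp: latin_square_def)

lemma latin_square_value_column:
  assumes "latin_square n L"
  shows "bij_betw (\<lambda>(x, y). (L x y, y)) ({1..n} \<times> {1..n}) ({1..n} \<times> {1..n})"
proof -
  have "bij_betw (\<lambda>(y, x). (L x y, y)) ({1..n} \<times> {1..n}) ({1..n} \<times> {1..n})"
    using assms by (intro bij_betw_fibrewise) (auto simp: latin_square_def)
  moreover have "bij_betw prod.swap ({1..n} \<times> {1..n}) ({1..n} \<times> {1..n})"
    by (auto simp: bij_betw_def)
  ultimately have "bij_betw ((\<lambda>(y, x). (L x y, y)) \<circ> prod.swap)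
      ({1..n} \<times> {1..n}) ({1..n} \<times> {1..n})"
    by (rule bij_betw_trans[rotated])
  then show ?thesis
    by (simp add: comp_def case_prod_unfold)
qed

lemma latin_square_value_mem:
  assumes "latin_square n L" "x \<in> {1..n}" "y \<in> {1..n}"
  shows "L x y \<in> {1..n}"
  using assms bij_betwE unfolding latin_square_def by blast

theorem proposition6:
  fixes k n :: nat
    and L :: "nat \<Rightarrow> nat \<Rightarrow> nat \<Rightarrow> nat"
  assumes "k \<ge> 1" and "n \<ge> 1"
    and "\<forall>i\<in>{1..k}. latin_square n (L i)"
    and "mutually_orthogonal k n L"
  shows "mutually_invertible k n L"
proof -
  let ?G = "{1..n} \<times> {1..n}"
  let ?T = "\<lambda>(x, y). squares_tuple k L x y"
  have latin: "latin_square n (L i)" if "1 \<le> i" "i \<le> k" for i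
    using assms(3) that by simp
  have "two_extendable (k + 2) n (?T ` ?G)"
  proof (rule two_extendable_image)
    fix p assume "p \<in> ?G"
    then show "?T p \<in> tuples (k + 2) n"
      using latin_square_value_mem[OF latin]
      by (auto simp: squares_tuple_def tuples_def)
  next
    fix s\<^sub>1 s\<^sub>2
    assume s: "s\<^sub>1 \<in> {1..k + 2}" "s\<^sub>2 \<in> {1..k + 2}" "s\<^sub>1 < s\<^sub>2"
    let ?pair = "\<lambda>p. (?T p s\<^sub>1, ?T p s\<^sub>2)"
    consider "s\<^sub>2 \<le> k" | "s\<^sub>1 \<le> k" "s\<^sub>2 = k + 1" | "s\<^sub>1 \<le> k" "s\<^sub>2 = k + 2"
      | "s\<^sub>1 = k + 1" "s\<^sub>2 = k + 2"
      using s by fastforce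
    then show "bij_betw ?pair ?G ?G"
    proof cases
      case 1
      then have "?pair = (\<lambda>(x, y). (L s\<^sub>1 x y, L s\<^sub>2 x y))"
        using s by (auto simp: squares_tuple_def)
      moreover have "orthogonal_squares n (L s\<^sub>1) (L s\<^sub>2)"
        using assms(4) 1 s by (simp add: mutually_orthogonal_def)
      ultimately show ?thesis
        by (simp add: orthogonal_squares_def)
    next
      case 2
      then have "?pair = (\<lambda>(x, y). (L s\<^sub>1 x y, x))"
        using s by (auto simp: squares_tuple_def)
      then show ?thesis
        using latin_square_value_row[OF latin] 2 s by simp
    next
      case 3
      then have "?pair = (\<lambda>(x, y). (L s\<^sub>1 x y, y))"
        using s by (auto simp: squares_tuple_def)
      then show ?thesis
        using latin_square_value_column[OF latin] 3 s by simp
    next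
      case 4
      then have "?pair = id"
        by (auto simp: squares_tuple_def)
      then show ?thesis
        by simp
    qed
  qed
  moreover have "{squares_tuple k L x y | x y. x \<in> {1..n} \<and> y \<in> {1..n}} = ?T ` ?G"
    by force
  ultimately show ?thesis
    by (simp only: mutually_invertible_def)
qed

end
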